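(* Let $\mathcal{L}\in\{\mathrm{ML},\mathrm{ML}(\underline{\vee}),\mathrm{MDL},\mathrm{EMDL}\}$. The calculus $\mathbf{T}_{\mathcal{L}}$ is complete: every valid $\mathcal{L}$-formula $\varphi$ has a closed tableau for $\varphi$ in $\mathbf{T}_{\mathcal{L}}$.
   Context: Syntax (negation normal form): $\mathrm{ML}$: $\varphi::=p\mid\neg p\mid(\varphi\wedge\varphi)\mid(\varphi\vee\varphi)\mid\Diamond\varphi\mid\Box\varphi$; $\mathrm{ML}(\underline{\vee})$ adds $(\varphi\,\underline{\vee}\,\varphi)$; $\mathrm{MDL}$ adds atoms ${=}(p_1,\dots,p_n,q)$; $\mathrm{EMDL}$ adds atoms ${=}(\varphi_1,\dots,\varphi_n,\psi)$ with $\varphi_i,\psi\in\mathrm{ML}$. For $\chi\in\mathrm{ML}$, $\chi^\bot$ is the negation normal form of $\neg\chi$; $\chi^\top:=\chi$. Team semantics: Kripke model $K=(W,R,V)$, $W\ne\emptyset$, $R\subseteq W\times W$, $V:\Phi\to\mathcal{P}(W)$; team $T\subseteq W$. $K,T\models p$ iff $T\subseteq V(p)$; $K,T\models\neg p$ iff $T\cap V(p)=\emptyset$; $\wedge$ conjunctively; $K,T\models\varphi\vee\psi$ iff $T=T_1\cup T_2$ with $K,T_1\models\varphi$, $K,T_2\models\psi$; $K,T\models\varphi\,\underline{\vee}\,\psi$ iff $K,T\models\varphi$ or $K,T\models\psi$; $K,T\models\Diamond\varphi$ iff $K,T'\models\varphi$ for some $T'$ such that each $w\in T$ has an $R$-successor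 in $T'$ and each $v\in T'$ an $R$-predecessor in $T$; $K,T\models\Box\varphi$ iff $K,R[T]\models\varphi$ ($R[T]$ = successors of $T$); $K,T\models{=}(\varphi_1,\dots,\varphi_n,\psi)$ iff any $w,v\in T$ agreeing on the truth of all $\varphi_i$ (on singleton teams) agree on $\psi$. Valid: true in all Kripke models and all teams. $\mathrm{vrank}(\varphi)$: number of $\underline{\vee}$ in $\varphi$, each dependence atom ${=}(\varphi_1,\dots,\varphi_n,\psi)$ first replaced by $\bigvee_{\vec a\in\{\bot,\top\}^n}\bigwedge\{\varphi_1^{a_1},\dots,\varphi_n^{a_n},(\psi\,\underline{\vee}\,\psi^\bot)\}$. Labeled tableaux: labels are finite subsets of $\mathbb{N}$; nodes carry labeled formulas $\alpha:\varphi$ or accessibility formulas $i\mathsf{R}j$. A tableau is a finitely branching tree built from the root by rule applications; a rule extends a branch containing its premises by alternatives (separated by $\mid$), each adding all its listed items; a labeled formula is never added to a branch already containing it, and ($\Box$) is never applied twice to the same labeled formula on a branch. Rules: (Prop) from $\{i_1,\dots,i_k\}:p$: $\{i_1\}:p\mid\dots\mid\{i_k\}:p$; ($\neg$Prop) likewise for $\neg p$; ($\wedge$) from $\alpha:(\varphi\wedge\psi)$: $\alpha:\varphi\mid\alpha:\psi$; ($\vee$) from $\alpha:(\varphi\vee\psi)$ and any $\beta\subseteq\alpha$: $\beta:\varphi\mid\alpha\setminus\beta:\psi$; ($\underline{\vee}$) from $\alpha:(\varphi\,\underline{\vee}\,\psi)$: add $\alpha:\varphi$ and $\alpha:\psi$;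 (Split) from $\alpha:{=}(\vec\chi,\theta)$: $\alpha_1:{=}(\vec\chi,\theta)\mid\dots\mid\alpha_k:{=}(\vec\chi,\theta)$, $\alpha_1,\dots,\alpha_k$ all 2-element subsets of $\alpha$; (PL dep) from $\{i_1,i_2\}:{=}(p_1,\dots,p_n,q)$: one alternative per $g:\{1,\dots,n\}\to\{\top,\bot\}$ adding $\{i_1\}:p_m^{g(m)},\{i_2\}:p_m^{g(m)}$ ($m\le n$), $\{i_1,i_2\}:q$, $\{i_1,i_2\}:\neg q$; (ML dep) from $\{i_1,i_2\}:{=}(\varphi_1,\dots,\varphi_n,\psi)$: one alternative per $h:\{1,\dots,n\}\to\{\top,\bot\}$ adding $\{i_1\}:\varphi_m^{h(m)},\{i_2\}:\varphi_m^{h(m)}$ ($m\le n$), $\{i_1,i_2\}:\psi$, $\{i_1,i_2\}:\psi^\bot$; ($\Diamond$) from $\{i_1,\dots,i_n\}:\Diamond\varphi$ and $i_1\mathsf{R}j_1,\dots,i_n\mathsf{R}j_n$: add $\{j_1,\dots,j_n\}:\varphi$; ($\Box$) from $\alpha:\Box\varphi$, with $t=2^{\mathrm{vrank}(\varphi)}$ and fresh distinct $i_1,\dots,i_t$: one alternative per $f:\{1,\dots,t\}\to\alpha$ adding $f(1)\mathsf{R}i_1,\dots,f(t)\mathsf{R}i_t$ and $\{i_1,\dots,i_t\}:\varphi$. Calculi: $\mathbf{T}_{\mathrm{ML}}$ = (Prop),($\neg$Prop),($\wedge$),($\vee$),($\Diamond$),($\Box$); $\mathbf{T}_{\mathrm{ML}(\underline{\vee})}$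 adds ($\underline{\vee}$); $\mathbf{T}_{\mathrm{MDL}}$ adds (Split),(PL dep); $\mathbf{T}_{\mathrm{EMDL}}$ adds (Split),(ML dep). A tableau for $\varphi$ in $\mathbf{T}_{\mathcal{L}}$ has root $\{1,\dots,2^{\mathrm{vrank}(\varphi)}\}:\varphi$. A branch is closed if it contains (1) $\alpha:p$ and $\alpha:\neg p$, or (2) $\emptyset:\psi$, or (3) $\{i\}:{=}(p_1,\dots,p_n,q)$, or (4) $\{i\}:{=}(\varphi_1,\dots,\varphi_n,\psi)$ with $\varphi_i,\psi\in\mathrm{ML}$; a tableau is closed if all branches are closed. *)

theory Defs
  imports Main
begin

section \<open>Syntax\<close>

datatype 'p fm =
    Pos 'p
  | Neg 'p
  | And "'p fm" "'p fm"
  | Or "'p fm" "'p fm"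
  | IOr "'p fm" "'p fm"
  | Dia "'p fm"
  | Box "'p fm"
  | Dep "'p fm list" "'p fm"

datatype language = L_ML | L_MLIOr | L_MDL | L_EMDL

text \<open>
  \<open>IOr\<close> is the intuitionistic disjunction, and \<open>Dep [\<phi>\<^sub>1, \<dots>, \<phi>\<^sub>n] \<psi>\<close> is the
  dependence atom \<open>=(\<phi>\<^sub>1, \<dots>, \<phi>\<^sub>n, \<psi>)\<close>; the case \<open>n = 0\<close> (constancy) is included.
  The type admits arbitrary arguments in \<open>Dep\<close>; the restrictions of the four
  languages are imposed here.
\<close>

fun wff :: "language \<Rightarrow> 'p fm \<Rightarrow> bool" where
  "wff L (Pos p) = True"
| "wff L (Neg p) = True"
| "wff L (And \<phi> \<psi>) = (wff L \<phi> \<and> wff L \<psi>)"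
| "wff L (Or \<phi> \<psi>) = (wff L \<phi> \<and> wff L \<psi>)"
| "wff L (IOr \<phi> \<psi>) = (L = L_MLIOr \<and> wff L \<phi> \<and> wff L \<psi>)"
| "wff L (Dia \<phi>) = wff L \<phi>"
| "wff L (Box \<phi>) = wff L \<phi>"
| "wff L (Dep \<phi>s \<psi>) =
     (L = L_MDL \<and> (\<exists>ps q. \<phi>s = map Pos ps \<and> \<psi> = Pos q) \<or>
      L = L_EMDL \<and> (\<forall>\<chi>\<in>set \<phi>s. wff L_ML \<chi>) \<and> wff L_ML \<psi>)"

text \<open>Negation normal form of the negation; only meaningful (and only used) on ML.\<close>

fun dual :: "'p fm \<Rightarrow> 'p fm" where
  "dual (Pos p) = Neg p"
| "dual (Neg p) = Pos p"
| "dual (And \<phi> \<psi>) = Or (dual \<phi>) (dual \<psi>)"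
| "dual (Or \<phi> \<psi>) = And (dual \<phi>) (dual \<psi>)"
| "dual (Dia \<phi>) = Box (dual \<phi>)"
| "dual (Box \<phi>) = Dia (dual \<phi>)"

definition signed :: "'p fm \<Rightarrow> bool \<Rightarrow> 'p fm" where
  "signed \<chi> b = (if b then \<chi> else dual \<chi>)"


section \<open>Team semantics\<close>

record ('w, 'p) kripke =
  worlds :: "'w set"
  access :: "('w \<times> 'w) set"
  val :: "'p \<Rightarrow> 'w set"

definition kripke_model :: "('w, 'p) kripke \<Rightarrow> bool" where
  "kripke_model K \<longleftrightarrow>
     worlds K \<noteq> {} \<and> access K \<subseteq> worlds K \<times> worlds K \<and> (\<forall>p. val K p \<subseteq> worlds K)"

fun sat :: "('w, 'p) kripke \<Rightarrow> 'w set \<Rightarrow> 'p fm \<Rightarrow> bool" where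
  "sat K T (Pos p) = (T \<subseteq> val K p)"
| "sat K T (Neg p) = (T \<inter> val K p = {})"
| "sat K T (And \<phi> \<psi>) = (sat K T \<phi> \<and> sat K T \<psi>)"
| "sat K T (Or \<phi> \<psi>) = (\<exists>T1 T2. T = T1 \<union> T2 \<and> sat K T1 \<phi> \<and> sat K T2 \<psi>)"
| "sat K T (IOr \<phi> \<psi>) = (sat K T \<phi> \<or> sat K T \<psi>)"
| "sat K T (Dia \<phi>) =
     (\<exists>T'\<subseteq>worlds K. (\<forall>w\<in>T. \<exists>v\<in>T'. (w, v) \<in> access K) \<and>
        (\<forall>v\<in>T'. \<exists>w\<in>T. (w, v) \<in> access K) \<and> sat K T' \<phi>)"
| "sat K T (Box \<phi>) = sat K (access K `` T) \<phi>"
| "sat K T (Dep \<phi>s \<psi>) =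
     (\<forall>w\<in>T. \<forall>v\<in>T. (\<forall>\<chi>\<in>set \<phi>s. sat K {w} \<chi> \<longleftrightarrow> sat K {v} \<chi>) \<longrightarrow>
        (sat K {w} \<psi> \<longleftrightarrow> sat K {v} \<psi>))"

text \<open>
  Validity over all Kripke models whose set of worlds is a (nonempty) subset of the
  type \<open>'w\<close>. A formula cannot quantify over types, so \<open>'w\<close> is a parameter;
  it has to be infinite for validity over \<open>'w\<close> to say anything about all models.
\<close>

definition valid :: "'w itself \<Rightarrow> 'p fm \<Rightarrow> bool" where
  "valid (TYPE('w)) \<phi> \<longleftrightarrow>
     (\<forall>K :: ('w, 'p) kripke. kripke_model K \<longrightarrow> (\<forall>T\<subseteq>worlds K. sat K T \<phi>))"


section \<open>The rank \<open>vrank\<close>\<close>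

fun big_and :: "'p fm list \<Rightarrow> 'p fm" where
  "big_and [\<phi>] = \<phi>"
| "big_and (\<phi> # \<psi> # \<chi>s) = And \<phi> (big_and (\<psi> # \<chi>s))"

fun big_or :: "'p fm list \<Rightarrow> 'p fm" where
  "big_or [\<phi>] = \<phi>"
| "big_or (\<phi> # \<psi> # \<chi>s) = Or \<phi> (big_or (\<psi> # \<chi>s))"

text \<open>\<open>List.n_lists n [False, True]\<close> enumerates the sign vectors of length \<open>n\<close>.\<close>

definition dep_expand :: "'p fm list \<Rightarrow> 'p fm \<Rightarrow> 'p fm" where
  "dep_expand \<phi>s \<psi> =
     big_or [big_and (map2 signed \<phi>s bs @ [IOr \<psi> (dual \<psi>)]).
             bs \<leftarrow> List.n_lists (length \<phi>s) [False, True]]"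

primrec expand :: "'p fm \<Rightarrow> 'p fm" where
  "expand (Pos p) = Pos p"
| "expand (Neg p) = Neg p"
| "expand (And \<phi> \<psi>) = And (expand \<phi>) (expand \<psi>)"
| "expand (Or \<phi> \<psi>) = Or (expand \<phi>) (expand \<psi>)"
| "expand (IOr \<phi> \<psi>) = IOr (expand \<phi>) (expand \<psi>)"
| "expand (Dia \<phi>) = Dia (expand \<phi>)"
| "expand (Box \<phi>) = Box (expand \<phi>)"
| "expand (Dep \<phi>s \<psi>) = dep_expand \<phi>s \<psi>"

primrec count_IOr :: "'p fm \<Rightarrow> nat" where
  "count_IOr (Pos p) = 0"
| "count_IOr (Neg p) = 0"
| "count_IOr (And \<phi> \<psi>) = count_IOr \<phi> + count_IOr \<psi>"
| "count_IOr (Or \<phi> \<psi>) = count_IOr \<phi> + count_IOr \<psi>"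
| "count_IOr (IOr \<phi> \<psi>) = Suc (count_IOr \<phi> + count_IOr \<psi>)"
| "count_IOr (Dia \<phi>) = count_IOr \<phi>"
| "count_IOr (Box \<phi>) = count_IOr \<phi>"
| "count_IOr (Dep \<phi>s \<psi>) = 0"  \<comment> \<open>irrelevant: only applied to expanded formulas\<close>

definition vrank :: "'p fm \<Rightarrow> nat" where
  "vrank \<phi> = count_IOr (expand \<phi>)"


section \<open>Tableau rules\<close>

text \<open>
  \<open>Lab \<alpha> \<phi>\<close> is the labeled formula \<open>\<alpha>:\<phi>\<close> and \<open>Acc i j\<close> the accessibility formula
  \<open>iRj\<close>. Labels need not be required to be finite: the root label is finite and every
  rule below only produces finite labels from finite ones.
\<close>

datatype 'p item = Lab "nat set" "'p fm" | Acc nat nat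

primrec item_indices :: "'p item \<Rightarrow> nat set" where
  "item_indices (Lab \<alpha> \<phi>) = \<alpha>"
| "item_indices (Acc i j) = {i, j}"

definition indices :: "'p item set \<Rightarrow> nat set" where
  "indices B = (\<Union>x\<in>B. item_indices x)"

datatype rule_name =
  R_Prop | R_NegProp | R_And | R_Or | R_IOr | R_Split | R_PLdep | R_MLdep | R_Dia | R_Box

definition basic_rules :: "rule_name set" where
  "basic_rules = {R_Prop, R_NegProp, R_And, R_Or, R_Dia, R_Box}"

fun calculus :: "language \<Rightarrow> rule_name set" where
  "calculus L_ML = basic_rules"
| "calculus L_MLIOr = basic_rules \<union> {R_IOr}"
| "calculus L_MDL = basic_rules \<union> {R_Split, R_PLdep}"
| "calculus L_EMDL = basic_rules \<union> {R_Split, R_MLdep}"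

definition dep_alternative ::
  "nat \<Rightarrow> nat \<Rightarrow> 'p fm list \<Rightarrow> 'p fm \<Rightarrow> bool list \<Rightarrow> 'p item list" where
  "dep_alternative i j \<phi>s \<psi> bs =
     map2 (\<lambda>\<chi> b. Lab {i} (signed \<chi> b)) \<phi>s bs @
     map2 (\<lambda>\<chi> b. Lab {j} (signed \<chi> b)) \<phi>s bs @
     [Lab {i, j} \<psi>, Lab {i, j} (dual \<psi>)]"

definition dep_alternatives ::
  "nat \<Rightarrow> nat \<Rightarrow> 'p fm list \<Rightarrow> 'p fm \<Rightarrow> 'p item list list" where
  "dep_alternatives i j \<phi>s \<psi> =
     [dep_alternative i j \<phi>s \<psi> bs. bs \<leftarrow> List.n_lists (length \<phi>s) [False, True]]"

text \<open>
  \<open>rule_inst r B P As\<close>: on a branch with set of items \<open>B\<close>, the rule \<open>r\<close> has an instance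
  with principal labeled formula \<open>P\<close> and list of alternatives \<open>As\<close>, each alternative
  being the list of its items. In the case of \<open>R_Box\<close>, \<open>js\<close> lists the fresh indices, and
  the lists \<open>ks\<close> run through all functions from their positions to the label.
\<close>

inductive rule_inst ::
  "rule_name \<Rightarrow> 'p item set \<Rightarrow> 'p item \<Rightarrow> 'p item list list \<Rightarrow> bool" where
  Prop: "Lab (set is) (Pos p) \<in> B \<Longrightarrow> distinct is \<Longrightarrow>
     rule_inst R_Prop B (Lab (set is) (Pos p)) [[Lab {i} (Pos p)]. i \<leftarrow> is]"
| NegProp: "Lab (set is) (Neg p) \<in> B \<Longrightarrow> distinct is \<Longrightarrow>
     rule_inst R_NegProp B (Lab (set is) (Neg p)) [[Lab {i} (Neg p)]. i \<leftarrow> is]"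
| And: "Lab \<alpha> (And \<phi> \<psi>) \<in> B \<Longrightarrow>
     rule_inst R_And B (Lab \<alpha> (And \<phi> \<psi>)) [[Lab \<alpha> \<phi>], [Lab \<alpha> \<psi>]]"
| Or: "Lab \<alpha> (Or \<phi> \<psi>) \<in> B \<Longrightarrow> \<beta> \<subseteq> \<alpha> \<Longrightarrow>
     rule_inst R_Or B (Lab \<alpha> (Or \<phi> \<psi>)) [[Lab \<beta> \<phi>], [Lab (\<alpha> - \<beta>) \<psi>]]"
| IOr: "Lab \<alpha> (IOr \<phi> \<psi>) \<in> B \<Longrightarrow>
     rule_inst R_IOr B (Lab \<alpha> (IOr \<phi> \<psi>)) [[Lab \<alpha> \<phi>, Lab \<alpha> \<psi>]]"
| Split: "Lab \<alpha> (Dep \<phi>s \<psi>) \<in> B \<Longrightarrow> distinct \<gamma>s \<Longrightarrow> set \<gamma>s = {\<gamma>. \<gamma> \<subseteq> \<alpha> \<and> card \<gamma> = 2} \<Longrightarrow>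
     rule_inst R_Split B (Lab \<alpha> (Dep \<phi>s \<psi>)) [[Lab \<gamma> (Dep \<phi>s \<psi>)]. \<gamma> \<leftarrow> \<gamma>s]"
| PLdep: "Lab {i, j} (Dep (map Pos ps) (Pos q)) \<in> B \<Longrightarrow> i \<noteq> j \<Longrightarrow>
     rule_inst R_PLdep B (Lab {i, j} (Dep (map Pos ps) (Pos q)))
       (dep_alternatives i j (map Pos ps) (Pos q))"
| MLdep: "Lab {i, j} (Dep \<phi>s \<psi>) \<in> B \<Longrightarrow> i \<noteq> j \<Longrightarrow>
     \<forall>\<chi>\<in>set \<phi>s. wff L_ML \<chi> \<Longrightarrow> wff L_ML \<psi> \<Longrightarrow>
     rule_inst R_MLdep B (Lab {i, j} (Dep \<phi>s \<psi>)) (dep_alternatives i j \<phi>s \<psi>)"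
| Dia: "Lab (set is) (Dia \<phi>) \<in> B \<Longrightarrow> distinct is \<Longrightarrow>
     list_all2 (\<lambda>i j. Acc i j \<in> B) is js \<Longrightarrow>
     rule_inst R_Dia B (Lab (set is) (Dia \<phi>)) [[Lab (set js) \<phi>]]"
| Box: "Lab (set is) (Box \<phi>) \<in> B \<Longrightarrow> distinct is \<Longrightarrow>
     distinct js \<Longrightarrow> length js = 2 ^ vrank \<phi> \<Longrightarrow> set js \<inter> indices B = {} \<Longrightarrow>
     rule_inst R_Box B (Lab (set is) (Box \<phi>))
       [map2 Acc ks js @ [Lab (set js) \<phi>]. ks \<leftarrow> List.n_lists (length js) is]"


section \<open>Tableaux\<close>

datatype 'p tree = Node "'p item" "'p tree list"

primrec chain :: "'p item list \<Rightarrow> 'p tree list \<Rightarrow> 'p tree list" where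
  "chain [] ts = ts"
| "chain (x # xs) ts = [Node x (chain xs ts)]"

text \<open>The items of an alternative that are actually added to a branch with items \<open>B\<close>.\<close>

definition new_items :: "'p item set \<Rightarrow> 'p item list \<Rightarrow> 'p item list" where
  "new_items B A = remdups (filter (\<lambda>x. x \<notin> B) A)"

text \<open>
  \<open>expansion L B U ts\<close>: the trees \<open>ts\<close> may be placed below the end of a branch with set of
  items \<open>B\<close>, where \<open>U\<close> is the set of labeled formulas to which \<open>R_Box\<close> has already been
  applied on the branch. Each alternative of a rule application becomes a chain of new nodes;
  as an alternative that adds no node cannot be represented as a child, each of them
  has to contribute at least one new item. This is no loss: the branch obtained from an
  alternative without new items would be the branch that is being extended.
\<close>

inductive expansion ::
  "language \<Rightarrow> 'p item set \<Rightarrow> 'p item set \<Rightarrow> 'p tree list \<Rightarrow> bool"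
  for L :: language where
  stop: "expansion L B U []"
| apply_rule: "r \<in> calculus L \<Longrightarrow> rule_inst r B P As \<Longrightarrow> (r = R_Box \<longrightarrow> P \<notin> U) \<Longrightarrow>
     U' = (if r = R_Box then insert P U else U) \<Longrightarrow>
     list_all2 (\<lambda>A ts. new_items B A \<noteq> [] \<and> expansion L (B \<union> set A) U' ts) As tss \<Longrightarrow>
     expansion L B U (concat (map2 (\<lambda>A ts. chain (new_items B A) ts) As tss))"

definition root_item :: "'p fm \<Rightarrow> 'p item" where
  "root_item \<phi> = Lab {1..2 ^ vrank \<phi>} \<phi>"

definition tableau_for :: "language \<Rightarrow> 'p fm \<Rightarrow> 'p tree \<Rightarrow> bool" where
  "tableau_for L \<phi> t \<longleftrightarrow>
     (\<exists>ts. t = Node (root_item \<phi>) ts \<and> expansion L {root_item \<phi>} {} ts)"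

text \<open>Branches run from the root to a leaf.\<close>

inductive branch :: "'p tree \<Rightarrow> 'p item list \<Rightarrow> bool" where
  leaf: "branch (Node x []) [x]"
| down: "t \<in> set ts \<Longrightarrow> branch t b \<Longrightarrow> branch (Node x ts) (x # b)"

definition closed_branch :: "'p item list \<Rightarrow> bool" where
  "closed_branch b \<longleftrightarrow>
     (\<exists>\<alpha> p. Lab \<alpha> (Pos p) \<in> set b \<and> Lab \<alpha> (Neg p) \<in> set b) \<or>
     (\<exists>\<psi>. Lab {} \<psi> \<in> set b) \<or>
     (\<exists>i ps q. Lab {i} (Dep (map Pos ps) (Pos q)) \<in> set b) \<or>
     (\<exists>i \<phi>s \<psi>. Lab {i} (Dep \<phi>s \<psi>) \<in> set b \<and>
        (\<forall>\<chi>\<in>set \<phi>s. wff L_ML \<chi>) \<and> wff L_ML \<psi>)"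

definition closed_tableau :: "'p tree \<Rightarrow> bool" where
  "closed_tableau t \<longleftrightarrow> (\<forall>b. branch t b \<longrightarrow> closed_branch b)"

end

theory Submission
  imports Defs
begin

text \<open>
  A labeled formula \<open>\<alpha>:\<phi>\<close> on a branch asserts that the team \<open>\<alpha>\<close> falsifies \<open>\<phi>\<close>, so an open
  saturated branch describes a countermodel on its indices; downward closure of team semantics
  makes the rules sufficient for this. Saturation is reached because the indices are stratified
  into levels, the root label having level 0 and the indices created by \<open>R_Box\<close> on level \<open>d\<close>
  having level \<open>d + 1\<close>. Levels are bounded by the size of the root formula, and every rule
  application lowers, in the lexicographic order of the levels, the number of labeled formulas
  that can still be added or have \<open>R_Box\<close> applied to them. Hence, if no tableau closes, there is
  a branch that cannot be closed and that is minimal in this order, and it is saturated.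
\<close>

section \<open>Team semantics\<close>

text \<open>Each witness team is cut down to the part belonging to the smaller team: the two halves
  of a splitting are intersected with it, and a successor team keeps only successors of its points.
  The rules exploit this: falsifying a formula on part of a label falsifies it on the whole
  label.\<close>

lemma sat_downward_closed: "sat K T \<phi> \<Longrightarrow> S \<subseteq> T \<Longrightarrow> sat K S \<phi>"
proof (induction \<phi> arbitrary: S T)
  case (Or \<phi> \<psi>)
  then obtain T1 T2 where T: "T = T1 \<union> T2" "sat K T1 \<phi>" "sat K T2 \<psi>" by auto
  have "S = (S \<inter> T1) \<union> (S \<inter> T2)" using T(1) Or.prems(2) by blast
  moreover have "sat K (S \<inter> T1) \<phi>" "sat K (S \<inter> T2) \<psi>"
    using Or.IH T(2,3) by (meson inf_le2)+
  ultimately show ?case by auto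
next
  case (Dia \<phi>)
  then obtain T' where T': "T' \<subseteq> worlds K" "\<forall>w\<in>T. \<exists>v\<in>T'. (w, v) \<in> access K" "sat K T' \<phi>"
    by auto
  let ?S = "{v \<in> T'. \<exists>w\<in>S. (w, v) \<in> access K}"
  have "sat K ?S \<phi>" using Dia.IH T'(3) by (metis (no_types, lifting) mem_Collect_eq subsetI)
  moreover have "?S \<subseteq> worlds K" "\<forall>w\<in>S. \<exists>v\<in>?S. (w, v) \<in> access K"
    "\<forall>v\<in>?S. \<exists>w\<in>S. (w, v) \<in> access K" using T'(1,2) Dia.prems(2) by blast+
  ultimately show ?case unfolding sat.simps by blast
next
  case (Box \<phi>)
  then show ?case by (metis Image_mono order_refl sat.simps(7))
next
  case (Dep \<phi>s \<psi>)
  then show ?case by (simp add: subset_iff)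
qed auto

text \<open>This is why an empty label closes a branch: the empty team falsifies nothing.\<close>

lemma sat_empty: "sat K {} \<phi>"
proof (induction \<phi>)
  case (Or \<phi> \<psi>)
  then show ?case unfolding sat.simps by (metis Un_empty_left)
qed auto

lemma sat_singleton_Or: "sat K {w} (Or \<phi> \<psi>) \<longleftrightarrow> sat K {w} \<phi> \<or> sat K {w} \<psi>"
proof
  assume "sat K {w} (Or \<phi> \<psi>)"
  then obtain T1 T2 where "{w} = T1 \<union> T2" "sat K T1 \<phi>" "sat K T2 \<psi>" by auto
  then show "sat K {w} \<phi> \<or> sat K {w} \<psi>" by (metis Un_singleton_iff)
next
  assume "sat K {w} \<phi> \<or> sat K {w} \<psi>"
  then show "sat K {w} (Or \<phi> \<psi>)"
    using sat_empty unfolding sat.simps by (metis Un_empty_left Un_empty_right)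
qed

lemma sat_singleton_Dia:
  assumes "access K \<subseteq> worlds K \<times> worlds K"
  shows "sat K {w} (Dia \<phi>) \<longleftrightarrow> (\<exists>v. (w, v) \<in> access K \<and> sat K {v} \<phi>)"
proof
  assume "sat K {w} (Dia \<phi>)"
  then obtain T' v where "v \<in> T'" "(w, v) \<in> access K" "sat K T' \<phi>" by auto
  then show "\<exists>v. (w, v) \<in> access K \<and> sat K {v} \<phi>"
    using sat_downward_closed[of K T' \<phi> "{v}"] by blast
next
  assume "\<exists>v. (w, v) \<in> access K \<and> sat K {v} \<phi>"
  then obtain v where "(w, v) \<in> access K" "sat K {v} \<phi>" by blast
  then show "sat K {w} (Dia \<phi>)"
    using assms unfolding sat.simps by (intro exI[of _ "{v}"]) auto
qed

text \<open>Flatness of ML. For the direction from points to teams the witnesses are taken as large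
  as possible: all points of the team satisfying a disjunct, or all successors satisfying the
  body.\<close>

lemma sat_flat:
  assumes "access K \<subseteq> worlds K \<times> worlds K" "wff L_ML \<phi>"
  shows "sat K T \<phi> \<longleftrightarrow> (\<forall>w\<in>T. sat K {w} \<phi>)"
proof
  show "\<forall>w\<in>T. sat K {w} \<phi>" if "sat K T \<phi>"
    using sat_downward_closed[OF that] by simp
  show "sat K T \<phi>" if "\<forall>w\<in>T. sat K {w} \<phi>"
    using that assms(2)
  proof (induction \<phi> arbitrary: T)
    case (Or \<phi> \<psi>)
    have "T = {w\<in>T. sat K {w} \<phi>} \<union> {w\<in>T. sat K {w} \<psi>}"
      using Or.prems(1) unfolding sat_singleton_Or by blast
    moreover have "sat K {w\<in>T. sat K {w} \<phi>} \<phi>" "sat K {w\<in>T. sat K {w} \<psi>} \<psi>"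
      using Or.IH(1)[of "{w\<in>T. sat K {w} \<phi>}"] Or.IH(2)[of "{w\<in>T. sat K {w} \<psi>}"] Or.prems(2)
      by simp_all
    ultimately show ?case unfolding sat.simps by (intro exI conjI)
  next
    case (Dia \<phi>)
    let ?T' = "{v. sat K {v} \<phi> \<and> (\<exists>w\<in>T. (w, v) \<in> access K)}"
    have "sat K ?T' \<phi>" using Dia.IH[of ?T'] Dia.prems(2) by simp
    moreover have "\<forall>w\<in>T. \<exists>v\<in>?T'. (w, v) \<in> access K"
      using Dia.prems(1) unfolding sat_singleton_Dia[OF assms(1)] by blast
    moreover have "?T' \<subseteq> worlds K" "\<forall>v\<in>?T'. \<exists>w\<in>T. (w, v) \<in> access K"
      using assms(1) by blast+
    ultimately show ?case unfolding sat.simps by (intro exI[of _ ?T'] conjI)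
  next
    case (Box \<phi>)
    have "sat K {v} \<phi>" if "w \<in> T" "(w, v) \<in> access K" for v w
      using Box.prems(1) that sat_downward_closed[of K "access K `` {w}" \<phi> "{v}"] by auto
    then show ?case using Box.IH[of "access K `` T"] Box.prems(2) by auto
  next
    case (And \<phi> \<psi>)
    show ?case using And.prems And.IH(1)[of T] And.IH(2)[of T] by simp
  next
    case (IOr \<phi> \<psi>)
    from IOr.prems(2) show ?case by simp
  next
    case (Dep \<phi>s \<psi>)
    from Dep.prems(2) show ?case by simp
  qed auto
qed

section \<open>Duals of ML-formulas\<close>

lemma wff_dual: "wff L_ML \<phi> \<Longrightarrow> wff L_ML (dual \<phi>)"
  by (induction \<phi>) auto

lemma size_dual: "wff L_ML \<phi> \<Longrightarrow> size (dual \<phi>) = size \<phi>"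
  by (induction \<phi>) auto

text \<open>Duality is classical negation on single points only; a larger team may falsify both
  formulas. The modal cases need flatness, since \<open>Box\<close> evaluates its body on the whole
  successor team.\<close>

lemma sat_dual:
  assumes "access K \<subseteq> worlds K \<times> worlds K" "wff L_ML \<phi>"
  shows "sat K {w} (dual \<phi>) \<longleftrightarrow> \<not> sat K {w} \<phi>"
  using assms(2)
proof (induction \<phi> arbitrary: w)
  case (And \<phi> \<psi>)
  then show ?case by (simp add: sat_singleton_Or del: sat.simps(4))
next
  case (Or \<phi> \<psi>)
  then show ?case by (simp add: sat_singleton_Or del: sat.simps(4))
next
  case (Dia \<phi>)
  have "wff L_ML (dual \<phi>)" using wff_dual Dia.prems by auto
  note sat_flat[OF assms(1) this, of "access K `` {w}"]
  then have "sat K {w} (dual (Dia \<phi>)) \<longleftrightarrow> (\<forall>v. (w, v) \<in> access K \<longrightarrow> \<not> sat K {v} \<phi>)"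
    using Dia by (simp add: Ball_def)
  then show ?case unfolding sat_singleton_Dia[OF assms(1)] by blast
next
  case (Box \<phi>)
  have "wff L_ML \<phi>" using Box.prems by auto
  note sat_flat[OF assms(1) this, of "access K `` {w}"]
  moreover have "sat K {w} (dual (Box \<phi>)) \<longleftrightarrow> (\<exists>v. (w, v) \<in> access K \<and> \<not> sat K {v} \<phi>)"
    using Box by (simp add: sat_singleton_Dia[OF assms(1)] del: sat.simps(6))
  ultimately show ?case by (simp add: Ball_def del: sat.simps(6))
qed simp_all

lemma sat_signed:
  assumes "access K \<subseteq> worlds K \<times> worlds K" "wff L_ML \<phi>"
  shows "sat K {w} (signed \<phi> b) \<longleftrightarrow> (sat K {w} \<phi> \<longleftrightarrow> b)"
  using sat_dual[OF assms] by (simp add: signed_def)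


section \<open>The countermodel of an open saturated branch\<close>

definition closed_items :: "'p item set \<Rightarrow> bool" where
  "closed_items B \<longleftrightarrow>
     (\<exists>\<alpha> p. Lab \<alpha> (Pos p) \<in> B \<and> Lab \<alpha> (Neg p) \<in> B) \<or>
     (\<exists>\<psi>. Lab {} \<psi> \<in> B) \<or>
     (\<exists>i ps q. Lab {i} (Dep (map Pos ps) (Pos q)) \<in> B) \<or>
     (\<exists>i \<phi>s \<psi>. Lab {i} (Dep \<phi>s \<psi>) \<in> B \<and> (\<forall>\<chi>\<in>set \<phi>s. wff L_ML \<chi>) \<and> wff L_ML \<psi>)"

lemma closed_branch_iff: "closed_branch b \<longleftrightarrow> closed_items (set b)"
  by (simp add: closed_branch_def closed_items_def)

lemma label_subset_indices: "Lab \<alpha> \<phi> \<in> B \<Longrightarrow> \<alpha> \<subseteq> indices B"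
  unfolding indices_def by force

text \<open>What an open exhausted branch supplies. Fresh indices always allow \<open>R_Box\<close>
  to add something new, so \<open>saturated\<close> excludes it and \<open>Box_applied\<close>
  states what one application leaves behind. The map \<open>f\<close> places the indices in the type
  of worlds.\<close>

locale open_saturated =
  fixes L :: language and B :: "'p item set" and f :: "nat \<Rightarrow> 'w"
  assumes not_closed: "\<not> closed_items B"
    and finite_indices: "finite (indices B)"
    and saturated: "r \<in> calculus L \<Longrightarrow> r \<noteq> R_Box \<Longrightarrow> rule_inst r B P As \<Longrightarrow> As \<noteq> [] \<Longrightarrow> \<exists>A\<in>set As. set A \<subseteq> B"
    and Box_applied: "Lab \<alpha> (Box \<phi>) \<in> B \<Longrightarrow> \<exists>\<beta>. Lab \<beta> \<phi> \<in> B \<and> (\<forall>j\<in>\<beta>. \<exists>i\<in>\<alpha>. Acc i j \<in> B)"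
    and inj: "inj f"
begin

text \<open>Items on the branch are to be falsified, so \<open>Lab {i} (Neg p)\<close> asks for
  \<open>p\<close> to hold at \<open>f i\<close>. Taking all of \<open>range f\<close> makes the set
  of worlds nonempty; indices outside the branch become isolated worlds.\<close>

definition K :: "('w, 'p) kripke" where
  "K = \<lparr>worlds = range f, access = {(f i, f j) |i j. Acc i j \<in> B},
        val = \<lambda>p. f ` {i. Lab {i} (Neg p) \<in> B}\<rparr>"

lemma kripke_model_K: "kripke_model K"
  unfolding kripke_model_def K_def by auto

lemma access_K: "access K \<subseteq> worlds K \<times> worlds K"
  using kripke_model_K by (simp add: kripke_model_def)

lemma nonempty: "Lab \<alpha> \<phi> \<in> B \<Longrightarrow> \<alpha> \<noteq> {}"
  using not_closed by (auto simp: closed_items_def)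

lemma list_of_label:
  assumes "Lab \<alpha> \<phi> \<in> B"
  obtains xs where "set xs = \<alpha>" "distinct xs" "xs \<noteq> []"
proof -
  have "finite \<alpha>"
    using label_subset_indices[OF assms] finite_indices by (rule finite_subset)
  from finite_distinct_list[OF this] obtain xs where "set xs = \<alpha>" "distinct xs" by blast
  moreover from this(1) nonempty[OF assms] have "xs \<noteq> []" by auto
  ultimately show thesis by (rule that)
qed

lemma basic: "r \<in> basic_rules \<Longrightarrow> r \<in> calculus L"
  by (cases L) auto

text \<open>Openness excludes labels with fewer than two elements, so \<open>R_Split\<close> leads
  to a pair, and the dependence rule makes its two points agree on all \<open>\<phi>s\<close> but
  differ on \<open>\<psi>\<close>.\<close>

lemma falsifies_Dep:
  assumes "L = L_MDL \<and> (\<exists>ps q. \<phi>s = map Pos ps \<and> \<psi> = Pos q) \<or> L = L_EMDL"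
    and flat: "\<forall>\<chi>\<in>set \<phi>s. wff L_ML \<chi>" "wff L_ML \<psi>"
    and IH: "\<And>\<alpha> \<chi>. Lab \<alpha> \<chi> \<in> B \<Longrightarrow> wff L_ML \<chi> \<Longrightarrow> \<not> sat K (f ` \<alpha>) \<chi>"
    and "Lab \<alpha> (Dep \<phi>s \<psi>) \<in> B"
  shows "\<not> sat K (f ` \<alpha>) (Dep \<phi>s \<psi>)"
proof -
  obtain xs where xs: "set xs = \<alpha>" "distinct xs" "xs \<noteq> []"
    using list_of_label[OF assms(5)] .
  have fin: "finite \<alpha>" using xs by auto
  have "card \<alpha> \<noteq> 1"
  proof
    assume "card \<alpha> = 1"
    then obtain i where "\<alpha> = {i}" by (auto simp: card_1_singleton_iff)
    then have "closed_items B" unfolding closed_items_def using assms(5) flat by blast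
    then show False using not_closed by contradiction
  qed
  moreover have "card \<alpha> \<noteq> 0" using fin xs by auto
  ultimately have "2 \<le> card \<alpha>" by linarith
  obtain \<gamma>s where \<gamma>s: "set \<gamma>s = {\<gamma>. \<gamma> \<subseteq> \<alpha> \<and> card \<gamma> = 2}" "distinct \<gamma>s"
    using finite_distinct_list[of "{\<gamma>. \<gamma> \<subseteq> \<alpha> \<and> card \<gamma> = 2}"] fin by auto
  have "\<gamma>s \<noteq> []"
  proof -
    obtain \<gamma> where "\<gamma> \<subseteq> \<alpha>" "card \<gamma> = 2"
      by (rule obtain_subset_with_card_n[OF \<open>2 \<le> card \<alpha>\<close>])
    then have "\<gamma> \<in> set \<gamma>s" using \<gamma>s(1) by simp
    then show ?thesis by auto
  qed
  moreover have "R_Split \<in> calculus L" using assms(1) by auto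
  ultimately obtain \<gamma> where "\<gamma> \<in> set \<gamma>s" and \<gamma>B: "Lab \<gamma> (Dep \<phi>s \<psi>) \<in> B"
    using saturated[OF _ _ rule_inst.Split[OF assms(5) \<gamma>s(2,1)]] by auto
  then obtain i j where \<gamma>: "\<gamma> = {i, j}" "i \<noteq> j" "i \<in> \<alpha>" "j \<in> \<alpha>"
    using \<gamma>s(1) by (auto simp: card_2_iff)
  have ne: "dep_alternatives i j \<phi>s \<psi> \<noteq> []"
  proof -
    have "replicate (length \<phi>s) True \<in> set (List.n_lists (length \<phi>s) [False, True])"
      by (auto simp: set_n_lists)
    then show ?thesis unfolding dep_alternatives_def by force
  qed
  have "\<exists>A\<in>set (dep_alternatives i j \<phi>s \<psi>). set A \<subseteq> B"
  proof (cases "L = L_EMDL")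
    case True
    then show ?thesis
      using saturated[of R_MLdep, OF _ _ rule_inst.MLdep[OF \<gamma>B[unfolded \<gamma>(1)] \<gamma>(2) flat] ne] by simp
  next
    case False
    with assms(1) obtain ps q where "\<phi>s = map Pos ps" "\<psi> = Pos q" "L = L_MDL" by blast
    then show ?thesis
      using saturated[of R_PLdep, OF _ _ rule_inst.PLdep] \<gamma>B \<gamma> ne by simp
  qed
  then obtain bs where bs: "length bs = length \<phi>s" "set (dep_alternative i j \<phi>s \<psi> bs) \<subseteq> B"
    unfolding dep_alternatives_def by (auto simp: set_n_lists)
  \<comment> \<open>The alternative puts the same sign on \<open>\<chi>\<close> at \<open>i\<close>
    and at \<open>j\<close>. Both signed formulas are falsified, so \<open>\<chi>\<close> has the
    opposite truth value at both points.\<close>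
  have agree: "sat K {f i} \<chi> \<longleftrightarrow> sat K {f j} \<chi>" if \<chi>: "\<chi> \<in> set \<phi>s" for \<chi>
  proof -
    obtain m where m: "m < length \<phi>s" "\<chi> = \<phi>s ! m" using \<chi> by (auto simp: in_set_conv_nth)
    have "(\<chi>, bs ! m) \<in> set (zip \<phi>s bs)" using m bs(1) by (auto simp: set_zip)
    then have "Lab {i} (signed \<chi> (bs ! m)) \<in> B" "Lab {j} (signed \<chi> (bs ! m)) \<in> B"
      using bs(2) unfolding dep_alternative_def by force+
    moreover have "wff L_ML (signed \<chi> (bs ! m))"
      using flat(1) that by (simp add: signed_def wff_dual)
    ultimately have "\<not> sat K {f i} (signed \<chi> (bs ! m))" "\<not> sat K {f j} (signed \<chi> (bs ! m))"
      using IH[of "{i}"] IH[of "{j}"] by simp_all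
    then show ?thesis using sat_signed[OF access_K] flat(1) that by blast
  qed
  have "Lab {i, j} \<psi> \<in> B" "Lab {i, j} (dual \<psi>) \<in> B"
    using bs(2) unfolding dep_alternative_def by auto
  then have "\<not> sat K {f i, f j} \<psi>" "\<not> sat K {f i, f j} (dual \<psi>)"
    using IH[of "{i, j}"] flat(2) wff_dual by auto
  \<comment> \<open>By flatness \<open>\<psi>\<close> fails at one of the two points and its dual
    fails at one of them; as the dual negates \<open>\<psi>\<close> pointwise, these points are
    different.\<close>
  then have "sat K {f i} \<psi> \<longleftrightarrow> \<not> sat K {f j} \<psi>"
    using sat_flat[OF access_K flat(2), of "{f i, f j}"]
      sat_flat[OF access_K wff_dual[OF flat(2)], of "{f i, f j}"] sat_dual[OF access_K flat(2)]
    by auto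
  moreover have "f i \<in> f ` \<alpha>" "f j \<in> f ` \<alpha>" using \<gamma>(3,4) by auto
  ultimately show ?thesis unfolding sat.simps using agree by blast
qed

text \<open>
  The hypothesis \<open>Dep\<close> breaks the induction into two rounds: the rules for dependence atoms
  introduce duals, which are not subformulas, but only of ML-formulas.
\<close>

lemma falsifies_aux:
  assumes Dep: "\<And>\<alpha> \<phi>s \<psi>. Lab \<alpha> (Dep \<phi>s \<psi>) \<in> B \<Longrightarrow> wff L' (Dep \<phi>s \<psi>) \<Longrightarrow> \<not> sat K (f ` \<alpha>) (Dep \<phi>s \<psi>)"
    and "L' = L \<or> L' = L_ML"
  shows "Lab \<alpha> \<phi> \<in> B \<Longrightarrow> wff L' \<phi> \<Longrightarrow> \<not> sat K (f ` \<alpha>) \<phi>"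
proof (induction \<phi> arbitrary: \<alpha>)
  case (Pos p)
  obtain xs where xs: "set xs = \<alpha>" "distinct xs" "xs \<noteq> []" using list_of_label[OF Pos(1)] .
  obtain i where i: "i \<in> \<alpha>" "Lab {i} (Pos p) \<in> B"
    using saturated[OF basic _ rule_inst.Prop[OF Pos(1)[folded xs(1)] xs(2)]] xs
    by (auto simp: basic_rules_def)
  \<comment> \<open>The valuation at \<open>f i\<close> is decided by this item, and its presence
    would close the branch.\<close>
  with not_closed have "Lab {i} (Neg p) \<notin> B" unfolding closed_items_def by blast
  then show ?case using i(1) inj by (auto simp: K_def inj_image_subset_iff)
next
  case (Neg p)
  obtain xs where xs: "set xs = \<alpha>" "distinct xs" "xs \<noteq> []" using list_of_label[OF Neg(1)] .
  obtain i where i: "i \<in> \<alpha>" "Lab {i} (Neg p) \<in> B"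
    using saturated[OF basic _ rule_inst.NegProp[OF Neg(1)[folded xs(1)] xs(2)]] xs
    by (auto simp: basic_rules_def)
  then show ?case by (auto simp: K_def)
next
  case (And \<phi> \<psi>)
  then show ?case
    using saturated[OF basic _ rule_inst.And[OF And.prems(1)]] by (auto simp: basic_rules_def)
next
  case (Or \<phi> \<psi>)
  show ?case
  proof
    assume "sat K (f ` \<alpha>) (Or \<phi> \<psi>)"
    then obtain T1 T2 where T: "f ` \<alpha> = T1 \<union> T2" "sat K T1 \<phi>" "sat K T2 \<psi>" by auto
    \<comment> \<open>\<open>R_Or\<close> is available for every subset of the label, so it can
      follow the splitting that is to be refuted.\<close>
    let ?\<beta> = "{i\<in>\<alpha>. f i \<in> T1}"
    have "f ` ?\<beta> \<subseteq> T1" "f ` (\<alpha> - ?\<beta>) \<subseteq> T2" using T(1) by auto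
    then have "sat K (f ` ?\<beta>) \<phi>" "sat K (f ` (\<alpha> - ?\<beta>)) \<psi>"
      using sat_downward_closed[OF T(2)] sat_downward_closed[OF T(3)] by simp_all
    moreover have "Lab ?\<beta> \<phi> \<in> B \<or> Lab (\<alpha> - ?\<beta>) \<psi> \<in> B"
      using saturated[OF basic _ rule_inst.Or[OF Or.prems(1), of ?\<beta>]]
      by (auto simp: basic_rules_def)
    moreover have "wff L' \<phi>" "wff L' \<psi>" using Or.prems(2) by auto
    ultimately show False using Or.IH by blast
  qed
next
  case (IOr \<phi> \<psi>)
  then have "L = L_MLIOr" using assms(2) by auto
  then show ?case
    using saturated[of R_IOr, OF _ _ rule_inst.IOr[OF IOr.prems(1)]] IOr by auto
next
  case (Dia \<phi>)
  obtain xs where xs: "set xs = \<alpha>" "distinct xs" "xs \<noteq> []" using list_of_label[OF Dia.prems(1)] .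
  show ?case
  proof
    assume "sat K (f ` \<alpha>) (Dia \<phi>)"
    then obtain T' where T': "sat K T' \<phi>" "\<forall>w\<in>f ` \<alpha>. \<exists>v\<in>T'. (w, v) \<in> access K" by auto
    have "\<exists>j. Acc i j \<in> B \<and> f j \<in> T'" if "i \<in> \<alpha>" for i
    proof -
      obtain v where "v \<in> T'" "(f i, v) \<in> access K" using T'(2) \<open>i \<in> \<alpha>\<close> by blast
      then show ?thesis using inj unfolding K_def inj_def by auto
    qed
    \<comment> \<open>Applied to the successors selected by \<open>g\<close>, \<open>R_Dia\<close>
      yields a label whose image lies inside the supposed witness \<open>T'\<close>.\<close>
    then obtain g where g: "\<And>i. i \<in> \<alpha> \<Longrightarrow> Acc i (g i) \<in> B \<and> f (g i) \<in> T'" by metis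
    then have "list_all2 (\<lambda>i j. Acc i j \<in> B) xs (map g xs)"
      using xs(1) by (auto simp: list_all2_conv_all_nth)
    then have "Lab (g ` \<alpha>) \<phi> \<in> B"
      using saturated[OF basic _ rule_inst.Dia[OF Dia.prems(1)[folded xs(1)] xs(2)], of "map g xs"] xs(1)
      by (simp add: basic_rules_def)
    moreover have "sat K (f ` g ` \<alpha>) \<phi>" using g by (intro sat_downward_closed[OF T'(1)]) auto
    ultimately show False using Dia by auto
  qed
next
  case (Box \<phi>)
  obtain \<beta> where \<beta>: "Lab \<beta> \<phi> \<in> B" "\<forall>j\<in>\<beta>. \<exists>i\<in>\<alpha>. Acc i j \<in> B"
    using Box_applied[OF Box.prems(1)] by blast
  \<comment> \<open>The fresh label covers only part of the successor team; downward closure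
    transfers falsity to all of it.\<close>
  have "f ` \<beta> \<subseteq> access K `` (f ` \<alpha>)" using \<beta>(2) unfolding K_def by fastforce
  then show ?case using Box \<beta>(1) sat_downward_closed by (metis sat.simps(7) wff.simps(7))
next
  case (Dep \<phi>s \<psi>)
  then show ?case using assms(1) by blast
qed

lemma falsifies:
  assumes "Lab \<alpha> \<phi> \<in> B" "wff L \<phi>"
  shows "\<not> sat K (f ` \<alpha>) \<phi>"
proof -
  \<comment> \<open>In the first round the hypothesis on dependence atoms is vacuous, as none is an
    ML-formula.\<close>
  have flat: "\<not> sat K (f ` \<alpha>) \<phi>" if "Lab \<alpha> \<phi> \<in> B" "wff L_ML \<phi>" for \<alpha> \<phi>
    using falsifies_aux[of L_ML] that by auto
  have "\<not> sat K (f ` \<alpha>) (Dep \<phi>s \<psi>)" if "Lab \<alpha> (Dep \<phi>s \<psi>) \<in> B" "wff L (Dep \<phi>s \<psi>)" for \<alpha> \<phi>s \<psi>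
    by (rule falsifies_Dep) (use that flat in auto)
  then show ?thesis using falsifies_aux[of L] assms by blast
qed

end


section \<open>Closable branches\<close>

text \<open>The continuations of a branch by the trees \<open>ts\<close>. Without trees the branch
  ends, which leaves the empty continuation, so leaves and inner nodes are treated alike.\<close>

definition paths :: "'p tree list \<Rightarrow> 'p item list set" where
  "paths ts = (if ts = [] then {[]} else {b. \<exists>t\<in>set ts. branch t b})"

lemma branch_Node: "branch (Node x ts) b \<longleftrightarrow> (\<exists>b'\<in>paths ts. b = x # b')"
proof
  assume "branch (Node x ts) b"
  then show "\<exists>b'\<in>paths ts. b = x # b'"
    by cases (auto simp: paths_def)
next
  assume "\<exists>b'\<in>paths ts. b = x # b'"
  then show "branch (Node x ts) b"
    by (auto simp: paths_def split: if_splits intro: branch.intros)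
qed

lemma paths_chain: "paths (chain xs ts) = (@) xs ` paths ts"
proof (induction xs)
  case (Cons x xs)
  have "paths (chain (x # xs) ts) = Cons x ` paths (chain xs ts)"
    by (auto simp: paths_def[of "[_]"] branch_Node)
  then show ?case by (auto simp: Cons image_image)
qed (simp add: image_def)

definition closable :: "language \<Rightarrow> 'p item set \<Rightarrow> 'p item set \<Rightarrow> bool" where
  "closable L B U \<longleftrightarrow> (\<exists>ts. expansion L B U ts \<and> (\<forall>b\<in>paths ts. closed_items (B \<union> set b)))"

lemma closable_if_closed: "closed_items B \<Longrightarrow> closable L B U"
  unfolding closable_def by (intro exI[of _ "[]"]) (auto simp: paths_def intro: expansion.stop)

text \<open>Used in contrapositive form: if every alternative of an applicable rule adds something,
  an unclosable branch has an unclosable extension. With an empty list of alternatives the branch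
  would simply end, and nothing makes \<open>B\<close> itself closed.\<close>

lemma closable_if_alternatives:
  assumes rule: "r \<in> calculus L" "rule_inst r B P As" "r = R_Box \<longrightarrow> P \<notin> U"
    and "As \<noteq> []"
    and alt: "\<And>A. A \<in> set As \<Longrightarrow>
      \<not> set A \<subseteq> B \<and> closable L (B \<union> set A) (if r = R_Box then insert P U else U)"
  shows "closable L B U"
proof -
  let ?U = "if r = R_Box then insert P U else U"
  obtain g where g: "expansion L (B \<union> set A) ?U (g A)"
    "\<forall>b\<in>paths (g A). closed_items (B \<union> set A \<union> set b)" if "A \<in> set As" for A
    using alt unfolding closable_def by metis
  have new: "new_items B A \<noteq> []" if "A \<in> set As" for A
    using alt[OF that] by (auto simp: new_items_def filter_empty_conv)
  define ts where "ts = concat (map2 (\<lambda>A ts. chain (new_items B A) ts) As (map g As))"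
  have map2: "map2 (\<lambda>A ts. chain (new_items B A) ts) As (map g As)
      = map (\<lambda>A. chain (new_items B A) (g A)) As"
    by (rule nth_equalityI) simp_all
  have "list_all2 (\<lambda>A ts. new_items B A \<noteq> [] \<and> expansion L (B \<union> set A) ?U ts) As (map g As)"
    using g(1) new by (simp add: list_all2_conv_all_nth)
  then have "expansion L B U ts" using rule unfolding ts_def by (intro expansion.apply_rule) auto
  moreover have "closed_items (B \<union> set b)" if b: "b \<in> paths ts" for b
  proof -
    \<comment> \<open>A path must enter one of the chains, so that its items contain a whole
      alternative; the empty path is excluded once \<open>ts\<close> is nonempty.\<close>
    have nonempty: "chain (new_items B A) (g A) \<noteq> []" if "A \<in> set As" for A
      using new[OF that] by (cases "new_items B A") auto
    then have "ts \<noteq> []" using \<open>As \<noteq> []\<close> unfolding ts_def map2 by (cases As) auto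
    then obtain t where "t \<in> set ts" "branch t b" using b by (auto simp: paths_def)
    then obtain A where A: "A \<in> set As" "t \<in> set (chain (new_items B A) (g A))"
      unfolding ts_def map2 by auto
    then have "b \<in> paths (chain (new_items B A) (g A))"
      using \<open>branch t b\<close> nonempty[OF A(1)] by (auto simp: paths_def)
    then obtain b' where b': "b' \<in> paths (g A)" "b = new_items B A @ b'"
      unfolding paths_chain by auto
    have "B \<union> set b = B \<union> set A \<union> set b'" unfolding b'(2) new_items_def by auto
    then show ?thesis using g(2)[OF A(1)] b'(1) by simp
  qed
  ultimately show ?thesis unfolding closable_def by blast
qed


section \<open>Termination\<close>

definition fischer_ladner_closed :: "'p fm set \<Rightarrow> bool" where
  "fischer_ladner_closed S \<longleftrightarrow>
     (\<forall>\<phi> \<psi>. And \<phi> \<psi> \<in> S \<or> Or \<phi> \<psi> \<in> S \<or> IOr \<phi> \<psi> \<in> S \<longrightarrow> \<phi> \<in> S \<and> \<psi> \<in> S) \<and>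
     (\<forall>\<phi>. Dia \<phi> \<in> S \<or> Box \<phi> \<in> S \<longrightarrow> \<phi> \<in> S) \<and>
     (\<forall>\<phi>s \<psi>. Dep \<phi>s \<psi> \<in> S \<longrightarrow> (\<forall>\<chi>\<in>insert \<psi> (set \<phi>s). wff L_ML \<chi> \<longrightarrow> \<chi> \<in> S \<and> dual \<chi> \<in> S))"

primrec subformulas :: "'p fm \<Rightarrow> 'p fm set" where
  "subformulas (Pos p) = {Pos p}"
| "subformulas (Neg p) = {Neg p}"
| "subformulas (And \<phi> \<psi>) = insert (And \<phi> \<psi>) (subformulas \<phi> \<union> subformulas \<psi>)"
| "subformulas (Or \<phi> \<psi>) = insert (Or \<phi> \<psi>) (subformulas \<phi> \<union> subformulas \<psi>)"
| "subformulas (IOr \<phi> \<psi>) = insert (IOr \<phi> \<psi>) (subformulas \<phi> \<union> subformulas \<psi>)"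
| "subformulas (Dia \<phi>) = insert (Dia \<phi>) (subformulas \<phi>)"
| "subformulas (Box \<phi>) = insert (Box \<phi>) (subformulas \<phi>)"
| "subformulas (Dep \<phi>s \<psi>) =
     insert (Dep \<phi>s \<psi>) (\<Union> (set (map subformulas \<phi>s)) \<union> subformulas \<psi>)"

lemma finite_subformulas: "finite (subformulas \<phi>)"
  by (induction \<phi>) auto

lemma self_subformula [simp]: "\<phi> \<in> subformulas \<phi>"
  by (cases \<phi>) auto

lemma subformulas_mono: "\<psi> \<in> subformulas \<phi> \<Longrightarrow> subformulas \<psi> \<subseteq> subformulas \<phi>"
proof (induction \<phi>)
  case (Dep \<phi>s \<chi>)
  show ?case
  proof (cases "\<psi> = Dep \<phi>s \<chi>")
    case False
    with Dep.prems consider \<xi> where "\<xi> \<in> set \<phi>s" "\<psi> \<in> subformulas \<xi>" | "\<psi> \<in> subformulas \<chi>" by auto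
    then show ?thesis
    proof cases
      case 1
      with Dep.IH(1)[OF 1] show ?thesis by auto
    next
      case 2
      with Dep.IH(2)[OF 2] show ?thesis by auto
    qed
  qed auto
qed auto

text \<open>One round of duals suffices: the immediate parts of a dual are duals of immediate parts,
  and the dual of an ML-formula is never a dependence atom, so no dual of a dual is called
  for.\<close>

lemma finite_fischer_ladner_closure:
  obtains S where "finite S" "\<phi> \<in> S" "fischer_ladner_closed S"
proof
  let ?S = "subformulas \<phi> \<union> dual ` {\<psi> \<in> subformulas \<phi>. wff L_ML \<psi>}"
  show "finite ?S" by (simp add: finite_subformulas)
  show "\<phi> \<in> ?S" by simp
  have sub: "\<chi> \<in> subformulas \<phi>" if "\<psi> \<in> subformulas \<phi>" "\<chi> \<in> subformulas \<psi>" for \<chi> \<psi>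
    using subformulas_mono[OF that(1)] that(2) by blast
  have dual: "\<exists>\<chi>. \<psi> = dual \<chi> \<and> \<chi> \<in> subformulas \<phi> \<and> wff L_ML \<chi>"
    if "\<psi> \<in> ?S" "\<psi> \<notin> subformulas \<phi>" for \<psi>
    using that by blast
  have bin: "\<psi> \<in> ?S \<and> \<chi> \<in> ?S" if in_S: "And \<psi> \<chi> \<in> ?S \<or> Or \<psi> \<chi> \<in> ?S \<or> IOr \<psi> \<chi> \<in> ?S" for \<psi> \<chi>
  proof -
    obtain \<theta> where \<theta>: "\<theta> \<in> {And \<psi> \<chi>, Or \<psi> \<chi>, IOr \<psi> \<chi>}" "\<theta> \<in> ?S" using in_S by blast
    show ?thesis
    proof (cases "\<theta> \<in> subformulas \<phi>")
      case True
      moreover have "\<psi> \<in> subformulas \<theta>" "\<chi> \<in> subformulas \<theta>" using \<theta>(1) by auto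
      ultimately show ?thesis using sub by blast
    next
      case False
      then obtain \<xi> where \<xi>: "\<theta> = dual \<xi>" "\<xi> \<in> subformulas \<phi>" "wff L_ML \<xi>"
        using dual[OF \<theta>(2)] by blast
      then obtain \<psi>' \<chi>' where "\<xi> = And \<psi>' \<chi>' \<or> \<xi> = Or \<psi>' \<chi>'" "\<psi> = dual \<psi>'" "\<chi> = dual \<chi>'"
        using \<theta>(1) by (cases \<xi>) auto
      moreover from this have "\<psi>' \<in> subformulas \<xi>" "\<chi>' \<in> subformulas \<xi>" by auto
      ultimately show ?thesis using \<xi> sub by auto
    qed
  qed
  have un: "\<psi> \<in> ?S" if in_S: "Dia \<psi> \<in> ?S \<or> Box \<psi> \<in> ?S" for \<psi>
  proof -
    obtain \<theta> where \<theta>: "\<theta> \<in> {Dia \<psi>, Box \<psi>}" "\<theta> \<in> ?S" using in_S by blast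
    show ?thesis
    proof (cases "\<theta> \<in> subformulas \<phi>")
      case True
      moreover have "\<psi> \<in> subformulas \<theta>" using \<theta>(1) by auto
      ultimately show ?thesis using sub by blast
    next
      case False
      then obtain \<xi> where \<xi>: "\<theta> = dual \<xi>" "\<xi> \<in> subformulas \<phi>" "wff L_ML \<xi>"
        using dual[OF \<theta>(2)] by blast
      then obtain \<psi>' where "\<xi> = Dia \<psi>' \<or> \<xi> = Box \<psi>'" "\<psi> = dual \<psi>'"
        using \<theta>(1) by (cases \<xi>) auto
      moreover from this have "\<psi>' \<in> subformulas \<xi>" by auto
      ultimately show ?thesis using \<xi> sub by auto
    qed
  qed
  have dep: "\<chi> \<in> ?S \<and> dual \<chi> \<in> ?S"
    if in_S: "Dep \<phi>s \<psi> \<in> ?S" and \<chi>: "\<chi> \<in> insert \<psi> (set \<phi>s)" "wff L_ML \<chi>" for \<phi>s \<psi> \<chi>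
  proof -
    have "Dep \<phi>s \<psi> \<noteq> dual \<xi>" if "wff L_ML \<xi>" for \<xi>
      using that by (cases \<xi>) auto
    then have "Dep \<phi>s \<psi> \<in> subformulas \<phi>" using in_S by blast
    moreover have "\<chi> \<in> subformulas (Dep \<phi>s \<psi>)"
      using \<chi>(1) by (auto intro: bexI[of _ \<chi>])
    ultimately show ?thesis using sub \<chi>(2) by blast
  qed
  show "fischer_ladner_closed ?S"
    unfolding fischer_ladner_closed_def
    by (intro conjI; intro allI ballI impI; 
        (rule bin, assumption | rule un, assumption | rule dep, assumption+))
qed

section \<open>Levels and the termination measure\<close>

text \<open>
  Sizes can take the role of modal depths because no rule produces a formula larger than its
  premise. Only the empty label has several levels.
\<close>

fun leveled :: "'p fm set \<Rightarrow> nat \<Rightarrow> (nat \<Rightarrow> nat) \<Rightarrow> 'p item \<Rightarrow> bool" where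
  "leveled S D lev (Lab \<alpha> \<psi>) \<longleftrightarrow> \<psi> \<in> S \<and> (\<exists>d. d + size \<psi> \<le> D \<and> lev ` \<alpha> \<subseteq> {d})"
| "leveled S D lev (Acc i j) \<longleftrightarrow> lev j = Suc (lev i)"

text \<open>The last conjunct remembers the outcome of each use of \<open>R_Box\<close>, from which
  \<open>Box_applied\<close> is later obtained. Finiteness of the indices keeps fresh ones available
  and the measure finite.\<close>

definition stratified ::
  "'p fm set \<Rightarrow> nat \<Rightarrow> (nat \<Rightarrow> nat) \<Rightarrow> 'p item set \<Rightarrow> 'p item set \<Rightarrow> bool" where
  "stratified S D lev B U \<longleftrightarrow> finite (indices B) \<and> (\<forall>x\<in>B. leveled S D lev x) \<and>
     (\<forall>\<alpha> \<phi>. Lab \<alpha> (Box \<phi>) \<in> U \<longrightarrow> (\<exists>\<beta>. Lab \<beta> \<phi> \<in> B \<and> (\<forall>j\<in>\<beta>. \<exists>i\<in>\<alpha>. Acc i j \<in> B)))"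

definition at_level :: "'p fm set \<Rightarrow> (nat \<Rightarrow> nat) \<Rightarrow> 'p item set \<Rightarrow> nat \<Rightarrow> 'p item set" where
  "at_level S lev B d = case_prod Lab ` ({\<alpha>. \<alpha> \<subseteq> indices B \<and> lev ` \<alpha> \<subseteq> {d}} \<times> S)"

text \<open>The first summand pays for adding an item, the second for marking an item as used by
  \<open>R_Box\<close>. New indices can enlarge the supply only above the level of the
  \<open>Box\<close> premise.\<close>

definition budget ::
  "'p fm set \<Rightarrow> (nat \<Rightarrow> nat) \<Rightarrow> 'p item set \<Rightarrow> 'p item set \<Rightarrow> nat \<Rightarrow> nat" where
  "budget S lev B U d = card (at_level S lev B d - B) + card (at_level S lev B d - U)"

text \<open>Asking only for \<open>\<le>\<close> before the drop still gives the lexicographic order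
  on the levels up to \<open>D\<close>: an earlier strict drop is itself a witness.\<close>

definition lex_less :: "nat \<Rightarrow> (nat \<Rightarrow> nat) \<Rightarrow> (nat \<Rightarrow> nat) \<Rightarrow> bool" where
  "lex_less D m n \<longleftrightarrow> (\<exists>d\<le>D. m d < n d \<and> (\<forall>e<d. m e \<le> n e))"

text \<open>Well-foundedness for tuples of fixed length, by induction on the length: among the
  elements minimal in the first \<open>k\<close> components, one with least next component is
  chosen.\<close>

lemma lex_less_minimal:
  fixes m :: "'a \<Rightarrow> nat \<Rightarrow> nat"
  assumes "P x"
  shows "\<exists>y. P y \<and> (\<forall>z. P z \<longrightarrow> \<not> lex_less D (m z) (m y))"
proof -
  define less where "less k u v \<longleftrightarrow> (\<exists>d<k. u d < v d \<and> (\<forall>e<d. u e \<le> v e))"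
    for k and u v :: "nat \<Rightarrow> nat"
  have "\<exists>y. P y \<and> (\<forall>z. P z \<longrightarrow> \<not> less k (m z) (m y))" for k
  proof (induction k)
    case 0
    then show ?case using assms by (auto simp: less_def)
  next
    case (Suc k)
    define Q where "Q y \<longleftrightarrow> P y \<and> (\<forall>z. P z \<longrightarrow> \<not> less k (m z) (m y))" for y
    from Suc obtain y where y: "Q y" "\<And>z. Q z \<Longrightarrow> m y k \<le> m z k"
      using exists_least_iff[of "\<lambda>n. \<exists>y. Q y \<and> m y k = n"] unfolding Q_def
      by (metis (no_types, lifting) not_le_imp_less)
    have "\<not> less (Suc k) (m z) (m y)" if z: "P z" for z
    proof
      assume "less (Suc k) (m z) (m y)"
      then obtain d where d: "d < Suc k" "m z d < m y d" "\<forall>e<d. m z e \<le> m y e"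
        unfolding less_def by blast
      have not_less: "\<not> less k (m z) (m y)" using y(1) z unfolding Q_def by blast
      then have "d = k" using d unfolding less_def by (metis less_antisym)
      have "m z e = m y e" if "e < k" for e
        using not_less d(3) that unfolding less_def \<open>d = k\<close>
        by (metis le_neq_implies_less less_trans)
      \<comment> \<open>Agreeing with \<open>y\<close> on the first \<open>k\<close> components,
        \<open>z\<close> is minimal there too, so its smaller component \<open>k\<close> contradicts
        the choice of \<open>y\<close>.\<close>
      then have "less k u (m z) \<longleftrightarrow> less k u (m y)" for u
        unfolding less_def by (metis less_trans)
      then have "Q z" using y(1) z unfolding Q_def by simp
      then show False using y(2) d(2) \<open>d = k\<close> by (metis not_le)
    qed
    then show ?case using y(1) unfolding Q_def by blast
  qed
  from this[of "Suc D"] show ?thesis unfolding less_def lex_less_def less_Suc_eq_le .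
qed

section \<open>Effect of rule applications on levels and budgets\<close>

lemma finite_at_level:
  assumes "finite S" "finite (indices B)"
  shows "finite (at_level S lev B d)"
  unfolding at_level_def by (intro finite_imageI finite_cartesian_product assms(1)
    finite_subset[OF _ finite_Pow_iff[THEN iffD2, OF assms(2)]]) auto

lemma item_indices_subset: "x \<in> B \<Longrightarrow> item_indices x \<subseteq> indices B"
  unfolding indices_def by blast

lemma indices_Un: "indices (B \<union> C) = indices B \<union> indices C"
  unfolding indices_def by blast

text \<open>Apart from \<open>R_Dia\<close>, these rules keep to subsets of the premise's label and
  to formulas of no larger size. \<open>R_Dia\<close> moves to existing successors one level up, and
  the size of the formula drops by one in exchange.\<close>

lemma alternative_leveled:
  assumes S: "fischer_ladner_closed S" and B: "\<forall>x\<in>B. leveled S D lev x"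
    and rule: "rule_inst r B P As" and "r \<noteq> R_Box" "A \<in> set As" "x \<in> set A"
  shows "leveled S D lev x \<and> item_indices x \<subseteq> indices B \<and> x \<in> range (case_prod Lab)"
proof -
  have Lab: ?thesis
    if "Lab \<alpha> \<phi> \<in> B" "x = Lab \<beta> \<psi>" "\<beta> \<subseteq> \<alpha>" "\<psi> \<in> S" "size \<psi> \<le> size \<phi>" for \<alpha> \<phi> \<beta> \<psi>
  proof -
    from bspec[OF B that(1)] obtain d where "d + size \<phi> \<le> D" "lev ` \<alpha> \<subseteq> {d}" by auto
    then have "d + size \<psi> \<le> D" "lev ` \<beta> \<subseteq> {d}" using that by auto
    moreover have "\<beta> \<subseteq> indices B" using label_subset_indices[OF that(1)] that(3) by blast
    ultimately show ?thesis using that(2,4) by auto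
  qed
  have in_S: "\<phi> \<in> S" if "Lab \<alpha> \<phi> \<in> B" for \<alpha> \<phi>
    using bspec[OF B that] by simp
  have dep: ?thesis
    if D: "Lab {i, j} (Dep \<phi>s \<psi>) \<in> B" "As = dep_alternatives i j \<phi>s \<psi>"
      and flat: "\<forall>\<chi>\<in>set \<phi>s. wff L_ML \<chi>" "wff L_ML \<psi>" for i j \<phi>s \<psi>
  proof -
    obtain bs where x: "x \<in> set (dep_alternative i j \<phi>s \<psi> bs)"
      using assms(5,6) unfolding D(2) dep_alternatives_def by auto
    have sub: ?thesis
      if \<chi>: "\<beta> \<subseteq> {i, j}" "\<chi> \<in> insert \<psi> (set \<phi>s)" "x = Lab \<beta> \<chi> \<or> x = Lab \<beta> (dual \<chi>)" for \<beta> \<chi>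
    proof -
      have "wff L_ML \<chi>" using \<chi>(2) flat by auto
      moreover have "size \<chi> \<le> size (Dep \<phi>s \<psi>)"
        using \<chi>(2) size_list_estimation'[of \<chi> \<phi>s "size \<chi>" size] by auto
      moreover have "\<chi> \<in> S" "dual \<chi> \<in> S"
        using S in_S[OF D(1)] \<chi>(2) \<open>wff L_ML \<chi>\<close> unfolding fischer_ladner_closed_def by blast+
      ultimately show ?thesis
        using \<chi>(3) Lab[OF D(1) _ \<chi>(1)] size_dual by metis
    qed
    consider (signed) \<beta> \<chi> b where "(\<chi>, b) \<in> set (zip \<phi>s bs)" "\<beta> \<subseteq> {i, j}" "x = Lab \<beta> (signed \<chi> b)"
      | (plain) "x = Lab {i, j} \<psi> \<or> x = Lab {i, j} (dual \<psi>)"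
      using x unfolding dep_alternative_def by auto
    then show ?thesis
    proof cases
      case signed
      moreover from this(1) have "\<chi> \<in> set \<phi>s" by (rule set_zip_leftD)
      ultimately show ?thesis using sub[of \<beta> \<chi>] unfolding signed_def by (cases b) auto
    next
      case plain
      then show ?thesis using sub[of "{i, j}" \<psi>] by blast
    qed
  qed
  show ?thesis
    using rule
  proof cases
    case (Prop xs p)
    then show ?thesis using assms(5,6) in_S by (intro Lab[of "set xs" "Pos p"]) auto
  next
    case (NegProp xs p)
    then show ?thesis using assms(5,6) in_S by (intro Lab[of "set xs" "Neg p"]) auto
  next
    case (And \<alpha> \<phi> \<psi>)
    then have "\<phi> \<in> S \<and> \<psi> \<in> S" using S in_S unfolding fischer_ladner_closed_def by blast
    then show ?thesis
      using assms(5,6) And Lab[OF And(4), of \<alpha> \<phi>] Lab[OF And(4), of \<alpha> \<psi>] by auto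
  next
    case (Or \<alpha> \<phi> \<psi> \<beta>)
    then have "\<phi> \<in> S \<and> \<psi> \<in> S" using S in_S unfolding fischer_ladner_closed_def by blast
    then show ?thesis
      using assms(5,6) Or Lab[OF Or(4), of \<beta> \<phi>] Lab[OF Or(4), of "\<alpha> - \<beta>" \<psi>] by auto
  next
    case (IOr \<alpha> \<phi> \<psi>)
    then have "\<phi> \<in> S \<and> \<psi> \<in> S" using S in_S unfolding fischer_ladner_closed_def by blast
    then show ?thesis
      using assms(5,6) IOr Lab[OF IOr(4), of \<alpha> \<phi>] Lab[OF IOr(4), of \<alpha> \<psi>] by auto
  next
    case (Split \<alpha> \<phi>s \<psi> \<gamma>s)
    then obtain \<gamma> where "x = Lab \<gamma> (Dep \<phi>s \<psi>)" "\<gamma> \<subseteq> \<alpha>" using assms(5,6) by auto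
    then show ?thesis using Lab[OF Split(4)] in_S[OF Split(4)] by blast
  next
    case (PLdep i j ps q)
    then show ?thesis by (intro dep) auto
  next
    case (MLdep i j \<phi>s \<psi>)
    then show ?thesis by (intro dep) auto
  next
    case (Dia xs \<phi> js)
    from bspec[OF B Dia(4)] obtain d where d: "d + size (Dia \<phi>) \<le> D" "lev ` set xs \<subseteq> {d}" by auto
    have "j \<in> indices B \<and> lev j = Suc d" if j: "j \<in> set js" for j
    proof -
      obtain i where i: "i \<in> set xs" "Acc i j \<in> B"
        using Dia(6) j by (metis (no_types, lifting) in_set_conv_nth list_all2_conv_all_nth)
      then have "lev i = d" using d(2) by auto
      with i(2) show ?thesis using bspec[OF B i(2)] item_indices_subset[OF i(2)] by simp
    qed
    moreover have "\<phi> \<in> S" using S in_S[OF Dia(4)] unfolding fischer_ladner_closed_def by blast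
    moreover have "x = Lab (set js) \<phi>" using Dia(3) assms(5,6) by simp
    ultimately show ?thesis using d(1) by (auto intro!: exI[of _ "Suc d"])
  next
    case (Box xs \<phi> js)
    then show ?thesis using assms(4) by simp
  qed
qed

text \<open>The indices and their levels stay the same, so every level keeps its supply, and a new
  item uses up one element of it.\<close>

lemma stratified_step:
  assumes fin: "finite S" and S: "fischer_ladner_closed S" and strat: "stratified S D lev B U"
    and rule: "rule_inst r B P As" "r \<noteq> R_Box" "A \<in> set As" "\<not> set A \<subseteq> B"
  shows "stratified S D lev (B \<union> set A) U \<and>
    lex_less D (budget S lev (B \<union> set A) U) (budget S lev B U)"
proof
  have A: "leveled S D lev x" "item_indices x \<subseteq> indices B" "x \<in> range (case_prod Lab)" if "x \<in> set A" for x
    using alternative_leveled[OF S _ rule(1,2,3) that] strat unfolding stratified_def by blast+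
  have ind: "indices (B \<union> set A) = indices B"
    using A(2) unfolding indices_Un by (auto simp: indices_def)
  then show "stratified S D lev (B \<union> set A) U"
    using strat A(1) unfolding stratified_def by (metis UnCI UnE)
  have level: "at_level S lev (B \<union> set A) d = at_level S lev B d" for d
    unfolding at_level_def ind ..
  have fin_level: "finite (at_level S lev B d)" for d
    using finite_at_level fin strat unfolding stratified_def by blast
  have le: "budget S lev (B \<union> set A) U d \<le> budget S lev B U d" for d
    unfolding budget_def level using fin_level by (intro add_right_mono card_mono) auto
  obtain x where x: "x \<in> set A" "x \<notin> B" using rule(4) by blast
  then obtain \<alpha> \<psi> where "x = Lab \<alpha> \<psi>" using A(3)[OF x(1)] by auto
  moreover from this obtain d where "d + size \<psi> \<le> D" "lev ` \<alpha> \<subseteq> {d}" "\<psi> \<in> S"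
    using A(1)[OF x(1)] by auto
  ultimately have "x \<in> at_level S lev B d" using A(2)[OF x(1)] unfolding at_level_def by auto
  then have "card (at_level S lev B d - (B \<union> set A)) < card (at_level S lev B d - B)"
    using x fin_level by (intro psubset_card_mono) auto
  then have "budget S lev (B \<union> set A) U d < budget S lev B U d"
    unfolding budget_def level by simp
  then show "lex_less D (budget S lev (B \<union> set A) U) (budget S lev B U)"
    unfolding lex_less_def using le \<open>d + size \<psi> \<le> D\<close> add_leD1 by blast
qed

text \<open>The supply may grow at level \<open>d + 1\<close>, but level \<open>d\<close> strictly
  loses the principal item \<open>P\<close> from its second summand and no lower level gains
  anything; the lexicographic order therefore still decreases.\<close>

lemma stratified_step_Box:
  assumes fin: "finite S" and S: "fischer_ladner_closed S" and strat: "stratified S D lev B U"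
    and rule: "rule_inst R_Box B P As" "P \<notin> U" "A \<in> set As"
  shows "\<exists>lev'. stratified S D lev' (B \<union> set A) (insert P U) \<and>
    lex_less D (budget S lev' (B \<union> set A) (insert P U)) (budget S lev B U)"
  using rule(1)
proof cases
  case (Box xs \<phi> js)
  let ?B = "B \<union> set A" and ?U = "insert P U"
  have B: "\<forall>x\<in>B. leveled S D lev x" "finite (indices B)" using strat unfolding stratified_def by auto
  from bspec[OF B(1) Box(3)] obtain d
    where d: "d + size (Box \<phi>) \<le> D" "lev ` set xs \<subseteq> {d}" "Box \<phi> \<in> S" by auto
  have "\<phi> \<in> S" using S d(3) unfolding fischer_ladner_closed_def by blast
  obtain ks where A: "A = map2 Acc ks js @ [Lab (set js) \<phi>]" "length ks = length js" "set ks \<subseteq> set xs"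
    using rule(3) Box(2) by (auto simp: set_n_lists)
  have xs: "set xs \<subseteq> indices B" using label_subset_indices[OF Box(3)] .
  have zip: "i \<in> set xs \<and> j \<in> set js" if "(i, j) \<in> set (zip ks js)" for i j
    using that A(3) set_zip_leftD set_zip_rightD by fast
  \<comment> \<open>Freshness allows the levels of \<open>js\<close> to be chosen anew without
    affecting any item of \<open>B\<close>.\<close>
  define lev' where "lev' j = (if j \<in> set js then Suc d else lev j)" for j
  have old: "lev' i = lev i" if "i \<in> indices B" for i
    using that Box(7) unfolding lev'_def by auto
  have "leveled S D lev' x" if x: "x \<in> B" for x
  proof (cases x)
    case (Lab \<alpha> \<psi>)
    then have "lev' ` \<alpha> = lev ` \<alpha>" using old label_subset_indices[of \<alpha> \<psi> B] x by (intro image_cong) auto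
    then show ?thesis using bspec[OF B(1) x] Lab by simp
  next
    case (Acc i j)
    then show ?thesis using bspec[OF B(1) x] old item_indices_subset[OF x] by simp
  qed
  moreover have "leveled S D lev' x" if x: "x \<in> set A" for x
  proof -
    have "leveled S D lev' (Lab (set js) \<phi>)"
      using \<open>\<phi> \<in> S\<close> d(1) by (auto simp: lev'_def intro!: exI[of _ "Suc d"])
    moreover have "leveled S D lev' (Acc i j)" if "(i, j) \<in> set (zip ks js)" for i j
    proof -
      have "i \<in> set xs" "j \<in> set js" using zip[OF that] by auto
      then have "lev' i = d" using old[of i] xs d(2) by auto
      moreover have "lev' j = Suc d" using \<open>j \<in> set js\<close> by (simp add: lev'_def)
      ultimately show ?thesis by simp
    qed
    ultimately show ?thesis using x A(1) by auto
  qed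
  moreover have ind: "indices ?B \<subseteq> indices B \<union> set js"
  proof -
    have "item_indices x \<subseteq> indices B \<union> set js" if "x \<in> set A" for x
      using that xs unfolding A(1) by (auto dest!: zip)
    then show ?thesis unfolding indices_Un indices_def[of "set A"] by blast
  qed
  moreover have "\<exists>\<beta>. Lab \<beta> \<psi> \<in> ?B \<and> (\<forall>j\<in>\<beta>. \<exists>i\<in>\<alpha>. Acc i j \<in> ?B)" if "Lab \<alpha> (Box \<psi>) \<in> ?U" for \<alpha> \<psi>
  proof (cases "Lab \<alpha> (Box \<psi>) \<in> U")
    case True
    then show ?thesis using strat unfolding stratified_def by (meson UnCI)
  next
    case False
    then have \<alpha>: "\<alpha> = set xs" "\<psi> = \<phi>" using that Box(1) by auto
    have "\<exists>i\<in>\<alpha>. Acc i j \<in> set A" if j: "j \<in> set js" for j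
    proof -
      obtain n where n: "n < length js" "j = js ! n" using j by (metis in_set_conv_nth)
      then have "(ks ! n, j) \<in> set (zip ks js)" using A(2) by (auto simp: set_zip)
      then have "Acc (ks ! n) j \<in> set A" unfolding A(1) by force
      moreover have "ks ! n \<in> \<alpha>" using n A(2,3) \<alpha> by (metis nth_mem subsetD)
      ultimately show ?thesis by blast
    qed
    moreover have "Lab (set js) \<psi> \<in> set A" unfolding A(1) \<alpha> by simp
    ultimately show ?thesis by blast
  qed
  ultimately have strat': "stratified S D lev' ?B ?U"
    unfolding stratified_def using B(2) by (auto intro: finite_subset[OF ind])
  \<comment> \<open>Fresh indices have level \<open>Suc d\<close>, so no label up to level
    \<open>d\<close> contains one.\<close>
  have level: "at_level S lev' ?B e = at_level S lev B e" if "e \<le> d" for e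
  proof -
    have "\<alpha> \<subseteq> indices ?B \<and> lev' ` \<alpha> \<subseteq> {e} \<longleftrightarrow> \<alpha> \<subseteq> indices B \<and> lev ` \<alpha> \<subseteq> {e}" (is "?l \<longleftrightarrow> ?r") for \<alpha>
    proof
      assume l: ?l
      have "j \<notin> set js" if "j \<in> \<alpha>" for j
      proof
        assume "j \<in> set js"
        then have "lev' j = Suc d" by (simp add: lev'_def)
        moreover have "lev' j = e" using l that by auto
        ultimately show False using \<open>e \<le> d\<close> by simp
      qed
      then have "\<alpha> \<subseteq> indices B" using l ind by blast
      moreover from this have "lev' ` \<alpha> = lev ` \<alpha>" using old by (intro image_cong) auto
      ultimately show ?r using l by simp
    next
      assume r: ?r
      then have "lev' ` \<alpha> = lev ` \<alpha>" using old by (intro image_cong) auto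
      then show ?l using r unfolding indices_Un by auto
    qed
    then show ?thesis unfolding at_level_def by simp
  qed
  have fin_level: "finite (at_level S lev B e)" for e
    by (rule finite_at_level[OF fin B(2)])
  have "budget S lev' ?B ?U e \<le> budget S lev B U e" if "e \<le> d" for e
    unfolding budget_def level[OF that] using fin_level by (intro add_mono card_mono) auto
  moreover have "budget S lev' ?B ?U d < budget S lev B U d"
  proof -
    have "P \<in> at_level S lev B d" unfolding at_level_def Box(1) using d xs by auto
    then have "card (at_level S lev B d - ?U) < card (at_level S lev B d - U)"
      using rule(2) fin_level by (intro psubset_card_mono) auto
    moreover have "card (at_level S lev B d - ?B) \<le> card (at_level S lev B d - B)"
      using fin_level by (intro card_mono) auto
    ultimately show ?thesis unfolding budget_def level[OF order_refl] by linarith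
  qed
  ultimately have "lex_less D (budget S lev' ?B ?U) (budget S lev B U)"
    unfolding lex_less_def using d(1) by (intro exI[of _ d]) auto
  then show ?thesis using strat' by blast
qed


section \<open>Completeness\<close>

text \<open>A minimal choice replaces the construction of a branch: every extension offered by a
  rule is smaller, hence closable by minimality, and then the chosen branch would be closable as
  well.\<close>

lemma not_closable_imp_open_saturated:
  fixes \<phi> :: "'p fm" and f :: "nat \<Rightarrow> 'w"
  assumes "\<not> closable L {Lab \<alpha> \<phi>} {}" "finite \<alpha>" "inj f"
  shows "\<exists>B. open_saturated L B f \<and> Lab \<alpha> \<phi> \<in> B"
proof -
  obtain S where S: "finite S" "\<phi> \<in> S" "fischer_ladner_closed S"
    by (rule finite_fischer_ladner_closure)
  define D where "D = size \<phi>"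
  define bad where "bad lev B U \<longleftrightarrow> stratified S D lev B U \<and> Lab \<alpha> \<phi> \<in> B \<and> \<not> closable L B U" for lev B U
  \<comment> \<open>All root indices get level 0, so the size of the root formula bounds every
    level.\<close>
  have "bad (\<lambda>_. 0) {Lab \<alpha> \<phi>} {}"
    using assms S(2) by (auto simp: bad_def stratified_def D_def indices_def)
  then have "(\<lambda>(lev, B, U). bad lev B U) (\<lambda>_. 0, {Lab \<alpha> \<phi>}, {})" by simp
  from lex_less_minimal[where P = "\<lambda>(lev, B, U). bad lev B U", OF this,
      where m = "\<lambda>(lev, B, U). budget S lev B U" and D = D]
  obtain lev B U where bad: "bad lev B U"
    and minimal: "\<And>lev' B' U'. bad lev' B' U' \<Longrightarrow> \<not> lex_less D (budget S lev' B' U') (budget S lev B U)"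
    by auto
  from bad have strat: "stratified S D lev B U" and root: "Lab \<alpha> \<phi> \<in> B" and not_closable: "\<not> closable L B U"
    unfolding bad_def by auto
  then have fin: "finite (indices B)" and not_closed: "\<not> closed_items B"
    using closable_if_closed unfolding stratified_def by auto
  have "open_saturated L B f"
  proof
    fix r P As
    assume r: "r \<in> calculus L" "r \<noteq> R_Box" "rule_inst r B P As" "As \<noteq> []"
    show "\<exists>A\<in>set As. set A \<subseteq> B"
    proof (rule ccontr)
      assume new: "\<not> (\<exists>A\<in>set As. set A \<subseteq> B)"
      have "closable L (B \<union> set A) U" if "A \<in> set As" for A
        using stratified_step[OF S(1,3) strat r(3,2) that] minimal new that root
        unfolding bad_def by blast
      then have "closable L B U"
        using closable_if_alternatives[OF r(1,3)] r(2,4) new by auto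
      then show False using not_closable by contradiction
    qed
  next
    fix \<beta> \<psi>
    assume Box: "Lab \<beta> (Box \<psi>) \<in> B"
    have "Lab \<beta> (Box \<psi>) \<in> U"
    proof (rule ccontr)
      assume unused: "Lab \<beta> (Box \<psi>) \<notin> U"
      have "finite \<beta>" using label_subset_indices[OF Box] fin by (rule finite_subset)
      then obtain xs where xs: "set xs = \<beta>" "distinct xs" using finite_distinct_list by blast
      have "xs \<noteq> []" using not_closed Box xs(1) unfolding closed_items_def by auto
      obtain J where J: "J \<subseteq> - indices B" "finite J" "card J = 2 ^ vrank \<psi>"
        using infinite_arbitrarily_large[of "- indices B" "2 ^ vrank \<psi>"] fin by auto
      then obtain js where js: "set js = J" "distinct js" using finite_distinct_list by blast
      have len: "length js = 2 ^ vrank \<psi>" using js J(3) distinct_card by metis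
      let ?As = "[map2 Acc ks js @ [Lab (set js) \<psi>]. ks \<leftarrow> List.n_lists (length js) xs]"
      have rule: "rule_inst R_Box B (Lab \<beta> (Box \<psi>)) ?As"
        unfolding xs(1)[symmetric]
        by (rule rule_inst.Box) (use Box xs js J(1) len in auto)
      \<comment> \<open>The label is nonempty on an open branch, so at least the constant function
        into it provides an alternative.\<close>
      have "replicate (length js) (hd xs) \<in> set (List.n_lists (length js) xs)"
        using \<open>xs \<noteq> []\<close> by (auto simp: set_n_lists)
      then have "?As \<noteq> []" by force
      moreover have "R_Box \<in> calculus L" by (cases L) (auto simp: basic_rules_def)
      moreover have "\<not> set A \<subseteq> B \<and> closable L (B \<union> set A) (insert (Lab \<beta> (Box \<psi>)) U)"
        if A: "A \<in> set ?As" for A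
      proof
        \<comment> \<open>Since \<open>2 ^ vrank \<psi>\<close> is positive, the new label contains
          a fresh index, so every alternative adds a new item.\<close>
        have "js \<noteq> []" using len by auto
        then have "\<not> set js \<subseteq> indices B" using js(1) J(1) by (cases js) auto
        then have "Lab (set js) \<psi> \<notin> B" using label_subset_indices by blast
        moreover have "Lab (set js) \<psi> \<in> set A" using A by auto
        ultimately show "\<not> set A \<subseteq> B" by blast
        show "closable L (B \<union> set A) (insert (Lab \<beta> (Box \<psi>)) U)"
          using stratified_step_Box[OF S(1,3) strat rule unused A] minimal root
          unfolding bad_def by blast
      qed
      ultimately have "closable L B U"
        using closable_if_alternatives[OF _ rule, of L U] unused by simp
      then show False using not_closable by contradiction
    qed
    then show "\<exists>\<gamma>. Lab \<gamma> \<psi> \<in> B \<and> (\<forall>j\<in>\<gamma>. \<exists>i\<in>\<beta>. Acc i j \<in> B)"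
      using strat unfolding stratified_def by blast
  qed (use fin not_closed assms(3) in auto)
  then show ?thesis using root by blast
qed

theorem theorem9:
  fixes L :: language and \<phi> :: "'p fm"
  assumes "infinite (UNIV :: 'w set)"
    and "wff L \<phi>"
    and "valid TYPE('w) \<phi>"
  shows "\<exists>t. tableau_for L \<phi> t \<and> closed_tableau t"
proof -
  obtain f :: "nat \<Rightarrow> 'w" where f: "inj f"
    using infinite_countable_subset[OF assms(1)] by blast
  have "closable L {root_item \<phi>} {}"
  proof (rule ccontr)
    assume "\<not> closable L {root_item \<phi>} {}"
    then obtain B where B: "open_saturated L B f" "root_item \<phi> \<in> B"
      using not_closable_imp_open_saturated f unfolding root_item_def by blast
    interpret open_saturated L B f by (rule B(1))
    \<comment> \<open>The root label becomes a team of the countermodel that falsifies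
      \<open>\<phi>\<close>, against validity.\<close>
    have "\<not> sat K (f ` {1..2 ^ vrank \<phi>}) \<phi>"
      using falsifies B(2) assms(2) unfolding root_item_def by blast
    moreover have "f ` {1..2 ^ vrank \<phi>} \<subseteq> worlds K" by (auto simp: K_def)
    ultimately show False using assms(3) kripke_model_K unfolding valid_def by blast
  qed
  then obtain ts where ts: "expansion L {root_item \<phi>} {} ts"
    "\<forall>b\<in>paths ts. closed_items ({root_item \<phi>} \<union> set b)"
    unfolding closable_def by blast
  have "closed_tableau (Node (root_item \<phi>) ts)"
    using ts(2) unfolding closed_tableau_def branch_Node closed_branch_iff by auto
  then show ?thesis using ts(1) unfolding tableau_for_def by blast
qed

end
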